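(* Let $\ell>0$ be an integer and let $G$ be a clique-triod in which each of the three attached paths has length $\ell$. Then $\rho(G)=\left\lceil \frac{\ell}{2}\right\rceil$.
   Context: Patrol game with radius of capture $\rho\ge 0$ on a connected graph $G$: there is one cop and one robber. Before the game the cop fixes a walk in $G$ (his patrol: a sequence of vertices in which consecutive vertices are equal or adjacent), and the robber knows the entire patrol in advance, while the cop has no information about the robber. The cop starts at the first vertex of his patrol, then the robber chooses a starting vertex; afterwards the players alternate moves (cop first), the cop following his patrol and the robber moving to an adjacent vertex or staying put. The cop wins if at some moment the distance between the cop and the robber is at most $\rho$; otherwise the robber wins. $\rho(G)$ is the minimum $\rho\ge0$ for which the cop has a patrol capturing the robber regardless of the robber's play. A clique-triod is a graph obtained from a clique on at least $3$ vertices (the clique-origin) and three vertex-disjoint paths, each attached by one endpoint to a different vertex of the clique-origin (and otherwise disjoint from it). Path length means number of edges. *)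

theory Defs
  imports
    Graph_Theory.Graph_Theory
    "HOL-Library.Disjoint_Sets"
begin

text \<open>
  Simple graphs are symmetric loop-free digraphs (locales \<^locale>\<open>graph\<close> and
  \<^locale>\<open>pair_graph\<close>).
\<close>

definition gdist :: "('a, 'b) pre_digraph \<Rightarrow> 'a \<Rightarrow> 'a \<Rightarrow> ereal" where
  "gdist G u v = wf_digraph.\<mu> G (\<lambda>_. 1) u v"

definition lazy_walk :: "('a, 'b) pre_digraph \<Rightarrow> (nat \<Rightarrow> 'a) \<Rightarrow> bool" where
  "lazy_walk G w \<longleftrightarrow>
     (\<forall>t. w t \<in> verts G) \<and> (\<forall>t. w (Suc t) = w t \<or> w t \<rightarrow>\<^bsub>G\<^esub> w (Suc t))"

text \<open>
  Round \<open>t\<close> ends in the position \<open>(c t, r t)\<close>. The cop moves first in the next round, so the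
  position \<open>(c (Suc t), r t)\<close> also occurs and has to be tested for capture.
\<close>

definition captures :: "('a, 'b) pre_digraph \<Rightarrow> nat \<Rightarrow> (nat \<Rightarrow> 'a) \<Rightarrow> (nat \<Rightarrow> 'a) \<Rightarrow> bool" where
  "captures G \<rho> c r \<longleftrightarrow>
     (\<exists>t. gdist G (c t) (r t) \<le> ereal (real \<rho>) \<or> gdist G (c (Suc t)) (r t) \<le> ereal (real \<rho>))"

text \<open>
  The patrol \<open>c\<close> is fixed in advance and known to the robber, so a play of the robber against
  \<open>c\<close> is just an arbitrary lazy walk \<open>r\<close>, chosen after \<open>c\<close>.
\<close>

definition winning_patrol :: "('a, 'b) pre_digraph \<Rightarrow> nat \<Rightarrow> (nat \<Rightarrow> 'a) \<Rightarrow> bool" where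
  "winning_patrol G \<rho> c \<longleftrightarrow> lazy_walk G c \<and> (\<forall>r. lazy_walk G r \<longrightarrow> captures G \<rho> c r)"

definition patrol_radius :: "('a, 'b) pre_digraph \<Rightarrow> nat" where
  "patrol_radius G = (LEAST \<rho>. \<exists>c. winning_patrol G \<rho> c)"

text \<open>
  \<open>K\<close> is the clique-origin and \<open>P 0, P 1, P 2\<close> are the attached paths, given by their lists of
  vertices. The first vertex of each path is its attachment vertex and lies in \<open>K\<close>: paths are
  attached by identifying vertices, not by an additional edge.
\<close>

definition clique_triod :: "'a pair_pre_digraph \<Rightarrow> 'a set \<Rightarrow> (nat \<Rightarrow> 'a list) \<Rightarrow> bool" where
  "clique_triod G K P \<longleftrightarrow>
     finite K \<and> 3 \<le> card K \<and>
     (\<forall>i<3. P i \<noteq> [] \<and> distinct (P i) \<and> set (P i) \<inter> K = {hd (P i)}) \<and>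
     disjoint_family_on (\<lambda>i. set (P i)) {..<3} \<and>
     pverts G = K \<union> (\<Union>i<3. set (P i)) \<and>
     parcs G = {(u, v). u \<in> K \<and> v \<in> K \<and> u \<noteq> v} \<union>
               (\<Union>i<3. set (vwalk_arcs (P i)) \<union> (set (vwalk_arcs (P i)))\<inverse>)"

lemma vwalk_arcs_in_set: "(u, v) \<in> set (vwalk_arcs p) \<Longrightarrow> u \<in> set p \<and> v \<in> set p"
  by (induction p rule: vwalk_arcs.induct) auto

lemma vwalk_arcs_distinct: "distinct p \<Longrightarrow> (u, v) \<in> set (vwalk_arcs p) \<Longrightarrow> u \<noteq> v"
  by (induction p rule: vwalk_arcs.induct) auto

lemma clique_triod_pair_graph:
  assumes "clique_triod G K P"
  shows "pair_graph G"
proof -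
  from assms have
    fin: "finite K" and
    dist: "\<And>i. i < 3 \<Longrightarrow> distinct (P i)" and
    V: "pverts G = K \<union> (\<Union>i<3. set (P i))" and
    E: "parcs G = {(u, v). u \<in> K \<and> v \<in> K \<and> u \<noteq> v} \<union>
               (\<Union>i<3. set (vwalk_arcs (P i)) \<union> (set (vwalk_arcs (P i)))\<inverse>)"
    by (auto simp: clique_triod_def)
  have sub: "parcs G \<subseteq> pverts G \<times> pverts G"
    unfolding E V by (fastforce dest: vwalk_arcs_in_set)
  have finV: "finite (pverts G)"
    unfolding V using fin by auto
  have finE: "finite (parcs G)"
    using finite_subset[OF sub] finV by simp
  have sym: "sym (parcs G)"
    unfolding E sym_def by auto
  have noloop: "fst e \<noteq> snd e" if "e \<in> parcs G" for e
    using that unfolding E by (cases e) (auto dest: vwalk_arcs_distinct[OF dist])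
  show ?thesis
    by unfold_locales (use sub finV finE sym noloop in \<open>auto simp: symmetric_def\<close>)
qed

end

theory Submission
  imports Defs
begin

text \<open>
  Relative to a leg \<open>a\<close>, give each vertex the signed coordinate \<open>i\<close> if it is the \<open>i\<close>-th vertex of
  the leg, and \<open>- 1 - k\<close> if it lies outside the leg at distance \<open>k\<close> from the clique. The coordinate
  changes by at most 1 along an edge, and the distance from any vertex to a vertex of the leg is the
  difference of their coordinates.

  If \<open>2 * \<rho> < l\<close>, the robber stays \<open>\<rho> + 1\<close> above both the present and the next coordinate of the cop
  relative to his leg, and at its attachment vertex when this is negative. It fails only if the
  cop comes within distance \<open>\<rho>\<close> of the end of the robber's leg. The robber therefore always uses a
  leg different from the last and the next one whose end the cop threatens; he can change to a new
  leg through the clique when the cop threatens the end of a third one, as the cop is then at height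
  at least \<open>\<rho> + 1\<close> there.

  Conversely, with radius \<open>h = \<lceil>l / 2\<rceil>\<close> and \<open>m = \<lfloor>l / 2\<rfloor>\<close>, the cop walks down leg 0 from height \<open>m\<close>,
  up leg 1 to height \<open>m\<close> and back, and up leg 2 to height \<open>m\<close>. A robber whose coordinate relative to
  a leg exceeds that of the cop by more than \<open>h\<close> remains in this situation as long as the cop has
  coordinate at least \<open>- h\<close> in one of any two consecutive rounds, and it is impossible when the cop
  is at height \<open>m\<close> of that leg.
\<close>

section \<open>Paths as vertex lists, and the choice of an unthreatened leg\<close>

lemma set_vwalk_arcs: "set (vwalk_arcs p) = {(p ! i, p ! Suc i) | i. Suc i < length p}"
proof (induction p rule: vwalk_arcs.induct)
  case (3 x y xs)
  have "{(f i, g i) | i. Suc i < Suc (Suc n)} = insert (f 0, g 0) {(f (Suc i), g (Suc i)) | i. Suc i < Suc n}"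
    for f g :: "nat \<Rightarrow> 'a" and n
    by (auto simp: less_Suc_eq_0_disj)
  from this[of "\<lambda>i. (x # y # xs) ! i" "\<lambda>i. (x # y # xs) ! Suc i" "length xs"] 3 show ?case
    by simp
qed auto

text \<open>The value 0 off the list allows indices to be summed over all three legs: as these are
  disjoint, only the leg containing the vertex contributes.\<close>

definition list_index :: "'a list \<Rightarrow> 'a \<Rightarrow> nat" where
  "list_index p v = (if v \<in> set p then LEAST i. p ! i = v else 0)"

lemma list_index_nth:
  assumes "distinct p" "i < length p"
  shows "list_index p (p ! i) = i"
proof -
  have "(LEAST j. p ! j = p ! i) = i"
  proof (rule Least_equality)
    show "i \<le> j" if "p ! j = p ! i" for j
      using that assms by (metis le_cases nth_eq_iff_index_eq order.strict_trans1)
  qed simp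
  then show ?thesis
    using assms by (simp add: list_index_def)
qed

text \<open>Among three legs one always differs from both the leg of the last visit up to
  \<open>t\<close> and the leg of the first visit after \<open>t\<close>. Choosing it as a function
  of these two legs makes the choice constant as long as no visit occurs.\<close>

lemma avoid_last_and_next:
  fixes visited :: "nat \<Rightarrow> bool" and leg :: "nat \<Rightarrow> nat"
  obtains a where "\<And>t. a t < 3"
    and "\<And>t. visited t \<Longrightarrow> a t \<noteq> leg t"
    and "\<And>t. visited (Suc t) \<Longrightarrow> a t \<noteq> leg (Suc t)"
    and "\<And>t. \<not> visited (Suc t) \<Longrightarrow> a (Suc t) = (a t :: nat)"
proof -
  \<comment> \<open>The starting value \<open>leg 0\<close> is right if time 0 is a visit and
    harmless otherwise.\<close>
  define prev where "prev = rec_nat (leg 0) (\<lambda>t x. if visited (Suc t) then leg (Suc t) else x)"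
  have prev_Suc: "prev (Suc t) = (if visited (Suc t) then leg (Suc t) else prev t)" for t
    by (simp add: prev_def)
  have prev: "prev t = leg t" if "visited t" for t
    using that by (cases t) (simp_all add: prev_def)
  \<comment> \<open>Without a later visit the \<open>LEAST\<close> is unspecified;
    \<open>nxt_Suc\<close> still holds, because the predicates under \<open>LEAST\<close> agree at
    \<open>t\<close> and \<open>Suc t\<close>.\<close>
  define nxt where "nxt t = leg (LEAST u. t < u \<and> visited u)" for t
  have nxt: "nxt t = leg (Suc t)" if "visited (Suc t)" for t
    unfolding nxt_def using that by (intro arg_cong[of _ _ leg] Least_equality) auto
  have nxt_Suc: "nxt (Suc t) = nxt t" if "\<not> visited (Suc t)" for t
  proof -
    have "Suc t < u \<and> visited u \<longleftrightarrow> t < u \<and> visited u" for u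
      using that by (metis Suc_lessD Suc_lessI)
    then show ?thesis by (simp add: nxt_def)
  qed
  have "\<exists>x<3. x \<noteq> i \<and> x \<noteq> j" for i j :: nat
    by presburger
  then obtain g where g: "\<And>i j :: nat. g i j < (3::nat) \<and> g i j \<noteq> i \<and> g i j \<noteq> j"
    by metis
  show thesis
  proof (rule that[of "\<lambda>t. g (prev t) (nxt t)"])
    show "g (prev t) (nxt t) \<noteq> leg t" if "visited t" for t
      using g prev[OF that] by metis
    show "g (prev t) (nxt t) \<noteq> leg (Suc t)" if "visited (Suc t)" for t
      using g nxt[OF that] by metis
  qed (use g in \<open>simp_all add: prev_Suc nxt_Suc\<close>)
qed

section \<open>Vertices and arcs of a clique-triod with equal legs\<close>

locale equal_clique_triod =
  fixes G :: "'a pair_pre_digraph" and K :: "'a set" and P :: "nat \<Rightarrow> 'a list" and l :: nat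
  assumes l_pos: "l > 0"
    and triod: "clique_triod G K P"
    and leg_vwalk_length: "\<forall>i<3. vwalk_length (P i) = l"
begin

sublocale pair_graph G
  using triod by (rule clique_triod_pair_graph)

lemma length_leg: "a < 3 \<Longrightarrow> length (P a) = Suc l"
  using leg_vwalk_length l_pos by fastforce

lemma distinct_leg: "a < 3 \<Longrightarrow> distinct (P a)"
  using triod by (simp add: clique_triod_def)

lemma leg_Int_clique: "a < 3 \<Longrightarrow> set (P a) \<inter> K = {P a ! 0}"
  using triod by (simp add: clique_triod_def hd_conv_nth)

lemma legs_disjoint: "a < 3 \<Longrightarrow> b < 3 \<Longrightarrow> a \<noteq> b \<Longrightarrow> v \<in> set (P a) \<Longrightarrow> v \<notin> set (P b)"
  using triod by (auto simp: clique_triod_def disjoint_family_on_def disjoint_iff)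

lemma leg_nth_in_set: "a < 3 \<Longrightarrow> i \<le> l \<Longrightarrow> P a ! i \<in> set (P a)"
  by (simp add: length_leg)

lemma leg_nth_in_clique_iff:
  assumes "a < 3" "i \<le> l"
  shows "P a ! i \<in> K \<longleftrightarrow> i = 0"
proof -
  have "P a ! i \<in> K \<longleftrightarrow> P a ! i = P a ! 0"
    using leg_Int_clique[OF assms(1)] leg_nth_in_set[OF assms] by blast
  also have "\<dots> \<longleftrightarrow> i = 0"
    using assms by (intro nth_eq_iff_index_eq) (simp_all add: distinct_leg length_leg)
  finally show ?thesis .
qed

lemma pverts_eq: "pverts G = K \<union> (\<Union>i<3. set (P i))"
  using triod by (simp add: clique_triod_def)

lemma leg_nth_in_pverts: "a < 3 \<Longrightarrow> i \<le> l \<Longrightarrow> P a ! i \<in> pverts G"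
  unfolding pverts_eq using leg_nth_in_set by auto

lemma vertex_cases:
  assumes "v \<in> pverts G"
  obtains (leg) b i where "b < 3" "i \<le> l" "v = P b ! i"
  | (off_legs) "v \<in> K" "\<And>b. b < 3 \<Longrightarrow> v \<notin> set (P b)"
proof -
  have thesis if "b < 3" "v \<in> set (P b)" for b
    using that(1) that(2) by (auto simp: in_set_conv_nth length_leg less_Suc_eq_le intro: leg)
  then show thesis
    using assms off_legs unfolding pverts_eq by blast
qed

lemma parcs_eq: "parcs G = {(u, v). u \<in> K \<and> v \<in> K \<and> u \<noteq> v} \<union>
    (\<Union>i<3. set (vwalk_arcs (P i)) \<union> (set (vwalk_arcs (P i)))\<inverse>)"
  using triod by (simp add: clique_triod_def)

lemma arc_cases:
  assumes "(u, v) \<in> parcs G"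
  obtains (clique) "u \<in> K" "v \<in> K" "u \<noteq> v"
  | (up) b i where "b < 3" "i < l" "u = P b ! i" "v = P b ! Suc i"
  | (down) b i where "b < 3" "i < l" "v = P b ! i" "u = P b ! Suc i"
proof -
  have "thesis" if "b < 3" "(u, v) \<in> set (vwalk_arcs (P b)) \<or> (v, u) \<in> set (vwalk_arcs (P b))" for b
    using that(2) up[OF that(1)] down[OF that(1)] by (auto simp: set_vwalk_arcs length_leg[OF that(1)])
  then show thesis
    using assms clique unfolding parcs_eq by blast
qed

lemma clique_arc: "u \<in> K \<Longrightarrow> v \<in> K \<Longrightarrow> u \<noteq> v \<Longrightarrow> (u, v) \<in> parcs G"
  unfolding parcs_eq by simp

lemma leg_arc: "b < 3 \<Longrightarrow> i < l \<Longrightarrow> (P b ! i, P b ! Suc i) \<in> parcs G"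
  unfolding parcs_eq set_vwalk_arcs using length_leg by fastforce

lemma leg_arc': "b < 3 \<Longrightarrow> i < l \<Longrightarrow> (P b ! Suc i, P b ! i) \<in> parcs G"
  unfolding parcs_eq set_vwalk_arcs using length_leg by fastforce

section \<open>The signed coordinate relative to a leg\<close>

definition coord :: "nat \<Rightarrow> 'a \<Rightarrow> int" where
  "coord a v = (if v \<in> set (P a) then int (list_index (P a) v)
                else - 1 - int (\<Sum>b<3. list_index (P b) v))"

lemma coord_leg:
  assumes "a < 3" "b < 3" "i \<le> l"
  shows "coord a (P b ! i) = (if a = b then int i else - 1 - int i)"
proof -
  have "list_index (P c) (P b ! i) = (if c = b then i else 0)" if "c < 3" for c
    using that assms legs_disjoint[of b c "P b ! i"] leg_nth_in_set[of b i]
    by (auto simp: list_index_nth distinct_leg length_leg) (simp add: list_index_def)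
  then have "(\<Sum>c<3. list_index (P c) (P b ! i)) = (\<Sum>c<3. if c = b then i else 0)"
    by (intro sum.cong) auto
  also have "\<dots> = i"
    using assms by simp
  finally show ?thesis
    using assms legs_disjoint[of b a "P b ! i"] leg_nth_in_set[of b i]
    by (auto simp: coord_def list_index_nth distinct_leg length_leg)
qed

lemma coord_off_legs:
  assumes "a < 3" "\<And>b. b < 3 \<Longrightarrow> v \<notin> set (P b)"
  shows "coord a v = - 1"
  using assms by (simp add: coord_def list_index_def)

lemma coord_clique:
  assumes "a < 3" "v \<in> K"
  shows "coord a v = (if v = P a ! 0 then 0 else - 1)"
proof -
  have "v \<in> pverts G"
    using assms by (simp add: pverts_eq)
  then show ?thesis
  proof (cases rule: vertex_cases)
    case (leg b i)
    then have "i = 0"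
      using assms leg_nth_in_clique_iff by blast
    then show ?thesis
      using leg assms legs_disjoint[of a b v] leg_nth_in_set[of a 0] leg_nth_in_set[of b 0]
      by (auto simp: coord_leg)
  next
    case off_legs
    then show ?thesis
      using assms leg_nth_in_set[of a 0] by (auto simp: coord_off_legs)
  qed
qed

lemma coord_nonnegE:
  assumes "a < 3" "v \<in> pverts G" "0 \<le> coord a v"
  obtains i where "i \<le> l" "v = P a ! i" "coord a v = int i"
  using assms(2)
proof (cases rule: vertex_cases)
  case (leg b i)
  with assms have "b = a"
    by (auto simp: coord_leg split: if_splits)
  with leg assms that[of i] show ?thesis
    by (simp add: coord_leg)
next
  case off_legs
  with assms show ?thesis
    by (simp add: coord_off_legs)
qed

lemma coord_le: "a < 3 \<Longrightarrow> v \<in> pverts G \<Longrightarrow> coord a v \<le> int l"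
  by (cases "0 \<le> coord a v") (auto elim: coord_nonnegE)

lemma coord_arc:
  assumes "a < 3" "(u, v) \<in> parcs G"
  shows "\<bar>coord a u - coord a v\<bar> \<le> 1"
  using assms(2) by (cases rule: arc_cases) (use assms(1) in \<open>auto simp: coord_clique coord_leg\<close>)

lemma coord_awalk:
  assumes "a < 3" "awalk u p v"
  shows "\<bar>coord a u - coord a v\<bar> \<le> int (length p)"
  using assms(2)
proof (induction p arbitrary: u)
  case Nil
  then show ?case by (simp add: awalk_Nil_iff)
next
  case (Cons e p)
  then have "\<bar>coord a (snd e) - coord a v\<bar> \<le> int (length p)" "\<bar>coord a u - coord a (snd e)\<bar> \<le> 1"
    using coord_arc[OF assms(1), of u "snd e"] by (auto simp: awalk_Cons_iff)
  then show ?case by simp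
qed

section \<open>Distances from coordinates\<close>

lemma awalk_cost_one: "awalk_cost (\<lambda>_. 1) p = real (length p)"
  by (induction p) auto

lemma gdist_le_awalk: "awalk u p v \<Longrightarrow> gdist (with_proj G) u v \<le> ereal (real (length p))"
  unfolding gdist_def using min_cost_le_walk_cost[of u p v "\<lambda>_. 1"] by (simp add: awalk_cost_one)

lemma gdist_ge_coord:
  assumes "a < 3"
  shows "ereal (real_of_int \<bar>coord a u - coord a v\<bar>) \<le> gdist (with_proj G) u v"
  unfolding gdist_def \<mu>_def
proof (rule INF_greatest)
  fix p assume "p \<in> {p. awalk u p v}"
  then have "\<bar>coord a u - coord a v\<bar> \<le> int (length p)"
    using coord_awalk[OF assms] by simp
  then have "real_of_int \<bar>coord a u - coord a v\<bar> \<le> real_of_int (int (length p))"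
    by (rule of_int_le_iff[THEN iffD2])
  then show "ereal (real_of_int \<bar>coord a u - coord a v\<bar>) \<le> ereal (awalk_cost (\<lambda>_. 1) p)"
    by (simp add: awalk_cost_one)
qed

text \<open>Below the target on leg \<open>a\<close> one steps up. From any other leg vertex of
  positive height one steps down, which lowers the coordinate on leg \<open>a\<close> and raises it
  on the other legs. From a clique vertex other than \<open>P a ! 0\<close> the arc to
  \<open>P a ! 0\<close> raises it from -1 to 0.\<close>

lemma arc_towards:
  assumes "a < 3" "i \<le> l" "y \<in> pverts G" "coord a y \<noteq> int i"
  obtains (towards) z where "(y, z) \<in> parcs G" "z \<in> pverts G" "\<bar>coord a z - int i\<bar> + 1 = \<bar>coord a y - int i\<bar>"
proof -
  have to_leg: thesis if "y \<in> K" "y \<noteq> P a ! 0"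
  proof (rule towards[of "P a ! 0"])
  qed (use that assms in \<open>auto simp: clique_arc leg_nth_in_clique_iff leg_nth_in_pverts coord_leg coord_clique\<close>)
  show thesis
    using assms(3)
  proof (cases rule: vertex_cases)
    case (leg b j)
    show ?thesis
    proof (cases "b = a \<and> j < i")
      case True
      then show ?thesis
        using leg assms leg_arc[of b j] by (intro towards[of "P b ! Suc j"]) (auto simp: leg_nth_in_pverts coord_leg)
    next
      case False
      show ?thesis
      proof (cases j)
        case 0
        then show ?thesis
          using leg assms False legs_disjoint[of a b y] leg_nth_in_set[of a 0] leg_nth_in_set[of b 0]
          by (intro to_leg) (auto simp: leg_nth_in_clique_iff coord_leg split: if_splits)
      next
        case (Suc k)
        then show ?thesis
          using leg assms False leg_arc'[of b k]
          by (intro towards[of "P b ! k"]) (auto simp: leg_nth_in_pverts coord_leg)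
      qed
    qed
  next
    case off_legs
    then show ?thesis
      using to_leg leg_nth_in_set[of a 0] assms by auto
  qed
qed

lemma awalk_to_leg:
  assumes "a < 3" "i \<le> l" "y \<in> pverts G"
  shows "\<exists>p. awalk y p (P a ! i) \<and> int (length p) = \<bar>coord a y - int i\<bar>"
  using assms(3)
proof (induction "nat \<bar>coord a y - int i\<bar>" arbitrary: y)
  case 0
  then have "coord a y = int i" by simp
  with 0 assms obtain "y = P a ! i"
    by (auto elim: coord_nonnegE)
  then show ?case
    using 0 \<open>coord a y = int i\<close> by (intro exI[of _ "[]"]) (simp add: awalk_Nil_iff)
next
  case (Suc n)
  then have "coord a y \<noteq> int i" by simp
  then obtain z where z: "(y, z) \<in> parcs G" "z \<in> pverts G" "\<bar>coord a z - int i\<bar> + 1 = \<bar>coord a y - int i\<bar>"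
    using arc_towards[OF assms(1,2) Suc.prems] by metis
  moreover have "n = nat \<bar>coord a z - int i\<bar>"
    using Suc.hyps(2) z by linarith
  ultimately obtain p where "awalk z p (P a ! i)" "int (length p) = \<bar>coord a z - int i\<bar>"
    using Suc.hyps(1) by blast
  with z show ?case
    by (intro exI[of _ "(y, z) # p"]) (simp add: awalk_Cons_iff)
qed

text \<open>One endpoint has to lie on leg \<open>a\<close>: the attachment vertices of the other
  two legs both have coordinate -1 but are distinct.\<close>

lemma gdist_le_coord:
  assumes "a < 3" "y \<in> pverts G" "x \<in> pverts G" "0 \<le> coord a x"
  shows "gdist (with_proj G) y x \<le> ereal (real_of_int \<bar>coord a y - coord a x\<bar>)"
proof -
  obtain i where "i \<le> l" "x = P a ! i" "coord a x = int i"
    using coord_nonnegE assms by metis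
  with awalk_to_leg[OF assms(1) _ assms(2), of i] obtain p
    where "awalk y p x" "int (length p) = \<bar>coord a y - coord a x\<bar>"
    by auto
  then show ?thesis
    using gdist_le_awalk[of y p x] by (metis of_int_of_nat_eq)
qed

section \<open>Lazy walks in coordinates\<close>

lemma lazy_walk_iff: "lazy_walk (with_proj G) w \<longleftrightarrow>
    (\<forall>t. w t \<in> pverts G) \<and> (\<forall>t. w (Suc t) = w t \<or> (w t, w (Suc t)) \<in> parcs G)"
  by (simp add: lazy_walk_def)

lemma coord_lazy_walk:
  assumes "lazy_walk (with_proj G) w" "a < 3"
  shows "\<bar>coord a (w (Suc t)) - coord a (w t)\<bar> \<le> 1"
proof -
  have "w (Suc t) = w t \<or> (w t, w (Suc t)) \<in> parcs G"
    using assms(1) by (simp add: lazy_walk_iff)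
  then show ?thesis
    using coord_arc[OF assms(2), of "w t" "w (Suc t)"] by (auto simp: abs_minus_commute)
qed

lemma coord_other_leg:
  assumes "a < 3" "b < 3" "a \<noteq> b" "v \<in> pverts G" "0 \<le> coord b v"
  shows "coord a v = - 1 - coord b v"
  using coord_nonnegE[OF assms(2,4,5)] assms(1-3) by (metis coord_leg)

lemma leg_adjacent:
  assumes "a < 3" "i \<le> l" "j \<le> l" "\<bar>int i - int j\<bar> \<le> 1"
  shows "P a ! j = P a ! i \<or> (P a ! i, P a ! j) \<in> parcs G"
proof -
  have "j = i \<or> j = Suc i \<or> i = Suc j"
    using assms(4) by linarith
  then show ?thesis
    using assms leg_arc leg_arc' by auto
qed

lemma attachment_adjacent:
  assumes "a < 3" "b < 3"
  shows "P b ! 0 = P a ! 0 \<or> (P a ! 0, P b ! 0) \<in> parcs G"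
  using assms leg_nth_in_clique_iff clique_arc by (metis le0)

section \<open>Lower bound: the robber's escape\<close>

lemma not_winning_patrol:
  assumes "2 * \<rho> < l"
  shows "\<not> winning_patrol (with_proj G) \<rho> c"
proof
  assume win: "winning_patrol (with_proj G) \<rho> c"
  then have lazy: "lazy_walk (with_proj G) c"
    by (simp add: winning_patrol_def)
  then have c_in: "c t \<in> pverts G" for t
    by (simp add: lazy_walk_iff)
  define s where "s a t = coord a (c t)" for a t
  have s_step: "\<bar>s a (Suc t) - s a t\<bar> \<le> 1" if "a < 3" for a t
    unfolding s_def using coord_lazy_walk[OF lazy that] .
  have s_other: "s a t = - 1 - s b t" if "a < 3" "b < 3" "a \<noteq> b" "0 \<le> s b t" for a b t
    using coord_other_leg that c_in unfolding s_def by blast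
  define threat where "threat t b \<longleftrightarrow> b < 3 \<and> int l - int \<rho> \<le> s b t" for t b
  define leg where "leg t = (SOME b. threat t b)" for t
  have threat_leg: "threat t (leg t)" if "\<exists>b. threat t b" for t
    unfolding leg_def using someI_ex[OF that] .
  \<comment> \<open>A threatened leg has positive cop coordinate, which makes the coordinates
    relative to the other legs negative.\<close>
  have threat_unique: "b = leg t" if "threat t b" for t b
  proof (rule ccontr)
    assume "b \<noteq> leg t"
    moreover have "threat t (leg t)"
      using threat_leg that by blast
    ultimately show False
      using that s_other[of b "leg t" t] assms by (auto simp: threat_def)
  qed
  obtain a where a_less: "\<And>t. a t < 3"
    and a_now: "\<And>t. \<exists>b. threat t b \<Longrightarrow> a t \<noteq> leg t"
    and a_next: "\<And>t. \<exists>b. threat (Suc t) b \<Longrightarrow> a t \<noteq> leg (Suc t)"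
    and a_stay: "\<And>t. \<not> (\<exists>b. threat (Suc t) b) \<Longrightarrow> a (Suc t) = a t"
    using avoid_last_and_next[of "\<lambda>t. \<exists>b. threat t b" leg] by metis
  define f where "f b t = nat (max 0 (int \<rho> + 1 + max (s b t) (s b (Suc t))))" for b t
  \<comment> \<open>Without a threat both cop coordinates are at most \<open>l - \<rho> - 1\<close>,
    so adding \<open>\<rho> + 1\<close> does not pass the end of the leg.\<close>
  have f_le: "f (a t) t \<le> l" for t
  proof -
    have "\<not> threat t (a t)" "\<not> threat (Suc t) (a t)"
      using threat_unique a_now a_next by blast+
    then show ?thesis
      using a_less[of t] by (auto simp: threat_def f_def)
  qed
  define r where "r t = P (a t) ! f (a t) t" for t
  have r_coord: "coord (a t) (r t) = int (f (a t) t)" for t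
    using a_less f_le by (simp add: r_def coord_leg)
  have "lazy_walk (with_proj G) r"
    unfolding lazy_walk_iff
  proof (intro conjI allI)
    show "r t \<in> pverts G" for t
      unfolding r_def using a_less f_le leg_nth_in_pverts by blast
  next
    fix t
    show "r (Suc t) = r t \<or> (r t, r (Suc t)) \<in> parcs G"
    proof (cases "\<exists>b. threat (Suc t) b")
      case False
      then have "a (Suc t) = a t"
        by (rule a_stay)
      moreover have "\<bar>int (f (a t) t) - int (f (a t) (Suc t))\<bar> \<le> 1"
        using s_step[OF a_less, of t t] s_step[OF a_less, of t "Suc t"] unfolding f_def by linarith
      ultimately show ?thesis
        using leg_adjacent[OF a_less f_le, of "f (a t) (Suc t)"] f_le[of "Suc t"] by (simp add: r_def)
    next
      case True
      define b where "b = leg (Suc t)"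
      \<comment> \<open>Here \<open>2 * \<rho> < l\<close> enters: a threat means height at least
        \<open>l - \<rho> \<ge> \<rho> + 1\<close>. The robber's heights at \<open>t\<close> and
        \<open>Suc t\<close> depend on three consecutive cop positions; in all of them the cop has
        height at least \<open>\<rho>\<close> on leg \<open>b\<close>, so both heights are 0 and the
        robber can cross the clique.\<close>
      have b: "b < 3" "int \<rho> + 1 \<le> s b (Suc t)"
        using threat_leg[OF True] assms by (auto simp: b_def threat_def)
      have near: "int \<rho> \<le> s b u" if "u \<in> {t, Suc t, Suc (Suc t)}" for u
        using that b s_step[OF b(1), of t] s_step[OF b(1), of "Suc t"] by auto
      have far: "s e u \<le> - 1 - int \<rho>" if "u \<in> {t, Suc t, Suc (Suc t)}" "e < 3" "e \<noteq> b" for e u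
        using near[OF that(1)] s_other[OF that(2) b(1) that(3), of u] by simp
      have "a t \<noteq> b" "a (Suc t) \<noteq> b"
        using a_next[OF True] a_now[OF True] by (simp_all add: b_def)
      then have "f (a t) t = 0" "f (a (Suc t)) (Suc t) = 0"
        using far[of t "a t"] far[of "Suc t" "a t"] far[of "Suc t" "a (Suc t)"]
          far[of "Suc (Suc t)" "a (Suc t)"] a_less by (simp_all add: f_def)
      then show ?thesis
        unfolding r_def using attachment_adjacent[OF a_less a_less] by metis
    qed
  qed
  then have "captures (with_proj G) \<rho> c r"
    using win by (simp add: winning_patrol_def)
  then obtain t u where u: "u \<in> {t, Suc t}" "gdist (with_proj G) (c u) (r t) \<le> ereal (real \<rho>)"
    by (auto simp: captures_def)
  then have "ereal (real_of_int \<bar>s (a t) u - int (f (a t) t)\<bar>) \<le> ereal (real \<rho>)"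
    using gdist_ge_coord[OF a_less, of t "c u" "r t"] unfolding r_coord s_def by (rule_tac order_trans)
  then have "\<bar>s (a t) u - int (f (a t) t)\<bar> \<le> int \<rho>"
    by simp
  \<comment> \<open>By the choice of \<open>f\<close>, the gap is at least \<open>\<rho> + 1\<close>
    for both values of \<open>u\<close>.\<close>
  then show False
    using u(1) by (auto simp: f_def)
qed

section \<open>Upper bound: the cop's patrol\<close>

lemma not_captured_coord:
  assumes "\<not> captures (with_proj G) h c r" "lazy_walk (with_proj G) c" "lazy_walk (with_proj G) r"
    and "a < 3" "0 \<le> coord a (r t)" "u \<in> {t, Suc t}"
  shows "int h < \<bar>coord a (c u) - coord a (r t)\<bar>"
proof (rule ccontr)
  assume "\<not> ?thesis"
  then have "real_of_int \<bar>coord a (c u) - coord a (r t)\<bar> \<le> real h"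
    by linarith
  moreover have "gdist (with_proj G) (c u) (r t) \<le> ereal (real_of_int \<bar>coord a (c u) - coord a (r t)\<bar>)"
    using assms by (intro gdist_le_coord) (auto simp: lazy_walk_iff)
  ultimately have "gdist (with_proj G) (c u) (r t) \<le> ereal (real h)"
    by (meson ereal_less_eq(3) order_trans)
  then show False
    using assms(1,6) by (auto simp: captures_def)
qed

text \<open>The last assumption forces the robber onto leg \<open>a\<close>, where distances are
  coordinate differences. Each single move shrinks the gap by at most 1, hence to no less than
  \<open>h\<close>, and the absence of a capture excludes equality.\<close>

lemma robber_stays_above:
  assumes "\<not> captures (with_proj G) h c r" "lazy_walk (with_proj G) c" "lazy_walk (with_proj G) r"
    and "a < 3" "coord a (c t) + int h < coord a (r t)"
    and "- int h \<le> coord a (c t) \<or> - int h \<le> coord a (c (Suc t))"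
  shows "coord a (c (Suc t)) + int h < coord a (r (Suc t))"
proof -
  have c: "\<bar>coord a (c (Suc t)) - coord a (c t)\<bar> \<le> 1" and r: "\<bar>coord a (r (Suc t)) - coord a (r t)\<bar> \<le> 1"
    using coord_lazy_walk assms by blast+
  have nonneg: "0 \<le> coord a (r t)"
    using assms(5,6) c by linarith
  have above: "coord a (c (Suc t)) + int h < coord a (r t)"
    using not_captured_coord[OF assms(1-4) nonneg, of "Suc t"] assms(5) c by auto
  show ?thesis
  proof (cases "0 \<le> coord a (r (Suc t))")
    case True
    then show ?thesis
      using not_captured_coord[OF assms(1-4) True, of "Suc t"] above r by auto
  next
    \<comment> \<open>Leaving the leg requires robber coordinate 0 at time \<open>t\<close>; the gap
      then puts the cop below \<open>- h\<close> in both rounds, against the last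
      assumption.\<close>
    case False
    then show ?thesis
      using assms(5,6) above r c by linarith
  qed
qed

text \<open>The cop is at \<open>P 0 ! 0\<close> at time \<open>m\<close>, at height
  \<open>m\<close> of leg 1 at time \<open>2 * m + 1\<close>, at \<open>P 1 ! 0\<close> at time
  \<open>3 * m + 1\<close>, and at height \<open>m\<close> of leg 2 from time
  \<open>4 * m + 2\<close> on. The extra units are the two clique arcs; \<open>min\<close> makes him
  wait at the end, as patrols are infinite.\<close>

definition patrol :: "nat \<Rightarrow> nat \<Rightarrow> 'a" where
  "patrol m t =
     (if t \<le> m then P 0 ! (m - t)
      else if t \<le> 2 * m + 1 then P 1 ! (t - m - 1)
      else if t \<le> 3 * m + 1 then P 1 ! (3 * m + 1 - t)
      else P 2 ! (min (t - 3 * m - 2) m))"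

lemma lazy_walk_patrol:
  assumes "m \<le> l"
  shows "lazy_walk (with_proj G) (patrol m)"
  unfolding lazy_walk_iff
proof (intro conjI allI)
  show "patrol m t \<in> pverts G" for t
    using assms by (auto simp: patrol_def intro!: leg_nth_in_pverts)
next
  fix t
  show "patrol m (Suc t) = patrol m t \<or> (patrol m t, patrol m (Suc t)) \<in> parcs G"
  proof -
    consider "t < m" | "t = m" | "m < t" "t < 2 * m + 1" | "2 * m + 1 \<le> t" "t < 3 * m + 1"
      | "t = 3 * m + 1" "m < t" | "3 * m + 2 \<le> t"
      by linarith
    then show ?thesis
    proof cases
      case 1
      then show ?thesis
        using leg_adjacent[of 0 "m - t" "m - Suc t"] assms by (simp add: patrol_def)
    next
      case 2
      then show ?thesis
        using attachment_adjacent[of 0 1] by (simp add: patrol_def)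
    next
      case 3
      then show ?thesis
        using leg_adjacent[of 1 "t - m - 1" "t - m"] assms by (simp add: patrol_def)
    next
      case 4
      then have "patrol m t = P 1 ! (3 * m + 1 - t)"
        by (cases "t = 2 * m + 1") (simp_all add: patrol_def)
      moreover have "patrol m (Suc t) = P 1 ! (3 * m - t)"
        using 4 by (simp add: patrol_def)
      ultimately show ?thesis
        using 4 leg_adjacent[of 1 "3 * m + 1 - t" "3 * m - t"] assms by simp
    next
      case 5
      then have "patrol m t = P 1 ! 0"
        by (simp add: patrol_def)
      moreover have "patrol m (Suc t) = P 2 ! 0"
        using 5 by (simp add: patrol_def)
      ultimately show ?thesis
        using attachment_adjacent[of 1 2] by simp
    next
      case 6
      then have "patrol m t = P 2 ! (min (t - 3 * m - 2) m)" "patrol m (Suc t) = P 2 ! (min (Suc t - 3 * m - 2) m)"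
        by (simp_all add: patrol_def)
      then show ?thesis
        using leg_adjacent[of 2 "min (t - 3 * m - 2) m" "min (Suc t - 3 * m - 2) m"] assms by auto
    qed
  qed
qed

text \<open>The assumptions say that \<open>m\<close> and \<open>h\<close> are the halves of
  \<open>l\<close> rounded down and up. From height \<open>m\<close> the cop covers the leg upwards
  by \<open>m + h = l\<close> and downwards by \<open>m \<le> h\<close>.\<close>

lemma winning_patrol_patrol:
  assumes "m \<le> h" "h \<le> Suc m" "m + h = l"
  shows "winning_patrol (with_proj G) h (patrol m)"
  unfolding winning_patrol_def
proof (intro conjI allI impI)
  show lazy: "lazy_walk (with_proj G) (patrol m)"
    using assms by (intro lazy_walk_patrol) simp
  fix r
  assume r: "lazy_walk (with_proj G) r"
  then have r_in: "r t \<in> pverts G" for t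
    by (simp add: lazy_walk_iff)
  show "captures (with_proj G) h (patrol m) r"
  proof (rule ccontr)
    assume free: "\<not> ?thesis"
    note not_near = not_captured_coord[OF free lazy r]
    note stays_above = robber_stays_above[OF free lazy r]
    have h_pos: "0 < h" and m_le: "m \<le> l"
      using assms l_pos by auto
    define above where "above a t \<longleftrightarrow> coord a (patrol m t) + int h < coord a (r t)" for a t
    have not_above_middle: "\<not> above a t" if "a < 3" "coord a (patrol m t) = int m" for a t
      using coord_le[OF that(1) r_in[of t]] that(2) assms(3) by (simp add: above_def)

    have coord0: "coord 0 (patrol m t) = int (m - t)" if "t \<le> m" for t
      using that m_le by (simp add: patrol_def coord_leg)
    \<comment> \<open>At time 0 all of leg 0 is covered; during the descent the cop's height is at
      most \<open>h\<close>, so the robber cannot enter through the attachment vertex.\<close>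
    have below0: "coord 0 (r t) < 0" if "t \<le> m" for t
      using that
    proof (induction t)
      case 0
      show ?case
      proof (rule ccontr)
        assume "\<not> ?thesis"
        then show False
          using not_near[of 0 0 0] coord_le[OF _ r_in, of 0 0] coord0[of 0] assms by auto
      qed
    next
      case (Suc t)
      then have "coord 0 (r (Suc t)) \<le> 0"
        using coord_lazy_walk[OF r, of 0 t] by auto
      moreover have "coord 0 (r (Suc t)) \<noteq> 0"
        using not_near[of 0 "Suc t" "Suc t"] coord0[of "Suc t"] Suc.prems assms by auto
      ultimately show ?case by simp
    qed
    have at_m: "patrol m m = P 0 ! 0"
      by (simp add: patrol_def)
    \<comment> \<open>The cop at \<open>P 0 ! 0\<close> has coordinate -1 relative to legs 1 and 2,
      so an uncaptured robber on either is above him there. Clique vertices off the legs are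
      adjacent to the cop and \<open>h\<close> is positive.\<close>
    have above_m: "above 1 m \<or> above 2 m"
      using r_in[of m]
    proof (cases rule: vertex_cases)
      case (leg b i)
      then have "b \<noteq> 0"
        using below0[of m] by (cases "b = 0") (auto simp: coord_leg)
      then have "above b m"
        using not_near[of b m m] leg by (auto simp: above_def at_m coord_leg)
      moreover have "b = 1 \<or> b = 2"
        using leg \<open>b \<noteq> 0\<close> by linarith
      ultimately show ?thesis
        by blast
    next
      case off_legs
      then have "(P 0 ! 0, r m) \<in> parcs G"
        using leg_nth_in_set[of 0 0] by (intro clique_arc) (auto simp: leg_nth_in_clique_iff)
      then have "awalk (P 0 ! 0) [(P 0 ! 0, r m)] (r m)"
        using r_in by (simp add: awalk_simps)
      from gdist_le_awalk[OF this] have "gdist (with_proj G) (patrol m m) (r m) \<le> 1"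
        by (simp add: at_m one_ereal_def)
      also have "\<dots> \<le> ereal (real h)"
        using h_pos by simp
      finally show ?thesis
        using free by (auto simp: captures_def)
    qed
    have coord1: "coord 1 (patrol m t) = int t - int m - 1" if "m \<le> t" "t \<le> 2 * m + 1" for t
      using that m_le by (auto simp: patrol_def coord_leg)
    \<comment> \<open>Crossing from leg 0 to leg 1 keeps the coordinate at -1 at times
      \<open>m\<close> and \<open>m + 1\<close>, hence the exception at
      \<open>t = m\<close>.\<close>
    have coord2: "coord 2 (patrol m t) = (if t = m then - 1 else int m - int t)" if "m \<le> t" "t \<le> 2 * m + 1" for t
      using that m_le by (auto simp: patrol_def coord_leg)
    have above_1_or_2: "above 1 t \<or> above 2 t" if "m \<le> t" "t \<le> 2 * m + 1" for t
      using that
    proof (induction t rule: dec_induct)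
      case base
      show ?case by (fact above_m)
    next
      case (step t)
      have "above 1 (Suc t)" if "above 1 t"
        using stays_above[of 1 t] that coord1[of t] step h_pos by (auto simp: above_def)
      moreover have "above 2 (Suc t)" if "above 2 t"
        using stays_above[of 2 t] that coord2[of t] step assms(1) h_pos by (auto simp: above_def split: if_splits)
      ultimately show ?case
        using step by auto
    qed
    have "\<not> above 1 (2 * m + 1)"
      using coord1[of "2 * m + 1"] by (intro not_above_middle) auto
    then have above_2m1: "above 2 (2 * m + 1)"
      using above_1_or_2[of "2 * m + 1"] by simp
    have coord2': "coord 2 (patrol m t) = int t - 3 * int m - 2" if "2 * m + 1 \<le> t" "t \<le> 4 * m + 2" for t
      using that m_le by (cases "t = 2 * m + 1") (auto simp: patrol_def coord_leg)
    \<comment> \<open>At time \<open>2 * m + 1\<close> the cop's coordinate is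
      \<open>- m - 1\<close>, which is below \<open>- h\<close> if \<open>h = m\<close>. In the
      following round it is \<open>- m\<close>, so \<open>robber_stays_above\<close> applies through
      its second alternative.\<close>
    have "above 2 t" if "2 * m + 1 \<le> t" "t \<le> 4 * m + 2" for t
      using that
    proof (induction t rule: dec_induct)
      case base
      show ?case by (fact above_2m1)
    next
      case (step t)
      then show ?case
        using stays_above[of 2 t] coord2'[of "Suc t"] assms(1) by (auto simp: above_def)
    qed
    from this[of "4 * m + 2"] have "above 2 (4 * m + 2)"
      by simp
    moreover have "\<not> above 2 (4 * m + 2)"
      using coord2'[of "4 * m + 2"] by (intro not_above_middle) auto
    ultimately show False by blast
  qed
qed

section \<open>The exact value of the radius\<close>

lemma patrol_radius_eq: "patrol_radius (with_proj G) = (l + 1) div 2"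
  unfolding patrol_radius_def
proof (rule Least_equality)
  have "winning_patrol (with_proj G) ((l + 1) div 2) (patrol (l div 2))"
    by (rule winning_patrol_patrol) linarith+
  then show "\<exists>c. winning_patrol (with_proj G) ((l + 1) div 2) c"
    by blast
next
  fix \<rho> assume "\<exists>c. winning_patrol (with_proj G) \<rho> c"
  then have "\<not> 2 * \<rho> < l"
    using not_winning_patrol by blast
  then show "(l + 1) div 2 \<le> \<rho>"
    by linarith
qed

end

theorem theorem6:
  fixes G :: "'a pair_pre_digraph" and K :: "'a set" and P :: "nat \<Rightarrow> 'a list" and l :: nat
  assumes "l > 0"
    and "clique_triod G K P"
    and "\<forall>i<3. vwalk_length (P i) = l"
  shows "int (patrol_radius (with_proj G)) = \<lceil>real l / 2\<rceil>"
proof -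
  interpret equal_clique_triod G K P l
    by unfold_locales (use assms in auto)
  have "\<lceil>real l / 2\<rceil> = int ((l + 1) div 2)"
    by linarith
  then show ?thesis
    by (simp add: patrol_radius_eq)
qed

end
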